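(* Let $M$ be a reduced monoid (i.e., a cancellative commutative semigroup with identity whose only invertible element is the identity). The following conditions are equivalent. (a) $M$ is hereditarily atomic, i.e., every submonoid of $M$ is atomic. (b) $M$ satisfies the ascending chain condition on principal ideals (ACCP).
   Context: "Monoid" means a cancellative and commutative semigroup with identity, written additively. $\mathcal{U}(M)$ is the group of invertible elements of $M$. An element $a\in M\setminus\mathcal{U}(M)$ is an atom of $M$ if whenever $a=b+c$ with $b,c\in M$, either $b\in\mathcal{U}(M)$ or $c\in\mathcal{U}(M)$. An element of $M$ is atomic if it is invertible or can be written as a sum of finitely many atoms of $M$; $M$ is atomic if every element of $M$ is atomic. A principal ideal of $M$ is a subset of the form $b+M=\{b+m : m\in M\}$ with $b\in M$. $M$ satisfies the ACCP if for every ascending chain $(b_n+M)_{n\ge 1}$ of principal ideals of $M$ there is $n_0\in\mathbb{N}$ such that $b_n+M=b_{n+1}+M$ for every $n\ge n_0$. *)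

theory Defs
  imports "HOL-Algebra.Divisibility"
begin

text \<open>
  Monoids are HOL-Algebra structures, hence written multiplicatively: the sum b + c becomes
  \<open>b \<otimes> c\<close> and the principal ideal b + M becomes \<open>b <# carrier M\<close>.
  The cancellative commutative ones are those satisfying the locale \<^locale>\<open>comm_monoid_cancel\<close>.
\<close>

definition reduced_monoid :: "('a, 'b) monoid_scheme \<Rightarrow> bool" where
  "reduced_monoid M \<longleftrightarrow> comm_monoid_cancel M \<and> Units M = {\<one>\<^bsub>M\<^esub>}"

(* The library's irreducible is phrased through proper divisors; this is the factorization form. *)
definition monoid_atom :: "('a, 'b) monoid_scheme \<Rightarrow> 'a \<Rightarrow> bool" where
  "monoid_atom M a \<longleftrightarrow> a \<in> carrier M - Units M \<and>
     (\<forall>b\<in>carrier M. \<forall>c\<in>carrier M. a = b \<otimes>\<^bsub>M\<^esub> c \<longrightarrow> b \<in> Units M \<or> c \<in> Units M)"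

(* The empty list yields the identity, which is invertible anyway. *)
definition atomic_element :: "('a, 'b) monoid_scheme \<Rightarrow> 'a \<Rightarrow> bool" where
  "atomic_element M a \<longleftrightarrow> a \<in> Units M \<or>
     (\<exists>as. (\<forall>x\<in>set as. monoid_atom M x) \<and> a = foldr (\<otimes>\<^bsub>M\<^esub>) as \<one>\<^bsub>M\<^esub>)"

definition atomic_monoid :: "('a, 'b) monoid_scheme \<Rightarrow> bool" where
  "atomic_monoid M \<longleftrightarrow> (\<forall>a\<in>carrier M. atomic_element M a)"

(* Units and atoms of a submonoid N are taken in N itself, not in M. *)
definition hereditarily_atomic :: "('a, 'b) monoid_scheme \<Rightarrow> bool" where
  "hereditarily_atomic M \<longleftrightarrow> (\<forall>N. submonoid N M \<longrightarrow> atomic_monoid (M\<lparr>carrier := N\<rparr>))"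

definition principal_ideal :: "('a, 'b) monoid_scheme \<Rightarrow> 'a \<Rightarrow> 'a set" where
  "principal_ideal M b = b <#\<^bsub>M\<^esub> carrier M"

definition ACCP :: "('a, 'b) monoid_scheme \<Rightarrow> bool" where
  "ACCP M \<longleftrightarrow>
     (\<forall>b :: nat \<Rightarrow> 'a. (\<forall>n. b n \<in> carrier M) \<longrightarrow>
        (\<forall>n. principal_ideal M (b n) \<subseteq> principal_ideal M (b (Suc n))) \<longrightarrow>
        (\<exists>n0. \<forall>n\<ge>n0. principal_ideal M (b n) = principal_ideal M (b (Suc n))))"

end

theory Submission
  imports Defs
begin

text \<open>
  In a reduced monoid the ACCP says exactly that proper divisibility is well-founded. This
  passes to submonoids, because divisibility in a submonoid implies divisibility in the whole
  monoid, and well-founded induction then splits every element of a submonoid into atoms.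

  Conversely, let \<open>x = b 0\<close> start an infinite chain \<open>b n = c n \<otimes> b (Suc n)\<close> with all
  \<open>c n \<noteq> \<one>\<close>. In the submonoid generated by all \<open>b n\<close> and \<open>c n\<close> the only possible
  atoms are the quotients \<open>c n\<close>, so \<open>x\<close> can only be atomic there if it is a product of
  quotients (\<open>chain_start_in_span\<close>). The chain itself may well have this property, but it
  can be thinned out so that the quotients of the resulting subchain do \<^emph>\<open>not\<close> generate
  \<open>x\<close>, and hereditary atomicity fails.

  The subchain is found one term at a time, keeping \<open>x\<close> outside the submonoid generated by
  the quotients used so far (\<open>chain_step\<close>). The constant sequence \<open>c n = d\<close> shows that a fixed
  \<open>d \<noteq> \<one>\<close> has only finitely many powers dividing a given element; hence \<open>x\<close> has only
  finitely many cofactors with respect to a finitely generated submonoid. If no \<open>j > n\<close> were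
  a good next index, some positive power of the quotient of \<open>b n\<close> by \<open>b j\<close> would be
  such a cofactor for each \<open>j\<close>, and two indices would share both exponent and cofactor.
  Cancellation turns this into \<open>b i [^] m = b j [^] m\<close> with \<open>i < j\<close> and \<open>m > 0\<close>, which makes
  the quotient of \<open>b i\<close> by \<open>b j\<close> invertible.
\<close>

locale reduced_comm_monoid = comm_monoid_cancel +
  assumes Units_trivial: "Units G = {\<one>}"
begin

section \<open>Divisibility in a reduced monoid\<close>

lemma mult_eq_one:
  assumes "a \<in> carrier G" "b \<in> carrier G" "a \<otimes> b = \<one>"
  shows "a = \<one>"
proof -
  have "b \<otimes> a = \<one>" using assms m_comm by simp
  then have "a \<in> Units G" using assms unfolding Units_def by blast
  then show ?thesis using Units_trivial by simp
qed

lemma mult_left_fixed: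
  assumes "a \<in> carrier G" "b \<in> carrier G" "a \<otimes> b = b"
  shows "a = \<one>"
  using assms r_cancel[of a b "\<one>"] by simp

lemma pow_eq_one:
  assumes "a \<in> carrier G" "a [^] (m::nat) = \<one>" "m > 0"
  shows "a = \<one>"
proof -
  obtain k where "m = Suc k" using assms(3) gr0_implies_Suc by blast
  then have "a \<otimes> a [^] k = \<one>" using assms nat_pow_Suc2 by simp
  then show ?thesis using mult_eq_one assms(1) by blast
qed

lemma divides_antisym:
  assumes "a \<in> carrier G" "b \<in> carrier G" "a divides b" "b divides a"
  shows "a = b"
proof -
  obtain c where c: "c \<in> carrier G" "b = a \<otimes> c" using assms(3) by blast
  obtain d where d: "d \<in> carrier G" "a = b \<otimes> d" using assms(4) by blast
  have "a = (a \<otimes> c) \<otimes> d" using d(2) unfolding c(2) .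
  also have "\<dots> = (c \<otimes> d) \<otimes> a"
    using c(1) d(1) assms(1) by (simp add: m_ac)
  finally have "(c \<otimes> d) \<otimes> a = a" by (rule sym)
  then have "c \<otimes> d = \<one>" using mult_left_fixed c(1) d(1) assms(1) by simp
  then have "c = \<one>" using mult_eq_one[OF c(1) d(1)] by blast
  then show ?thesis using c(2) assms(1) by simp
qed

lemma properfactor_iff:
  assumes "a \<in> carrier G" "b \<in> carrier G"
  shows "properfactor G a b \<longleftrightarrow> (\<exists>c\<in>carrier G - {\<one>}. b = c \<otimes> a)"
proof
  assume pf: "properfactor G a b"
  then obtain c where c: "c \<in> carrier G" "b = a \<otimes> c" unfolding properfactor_def by blast
  have "c \<noteq> \<one>" using pf c assms unfolding properfactor_def by auto
  then show "\<exists>c\<in>carrier G - {\<one>}. b = c \<otimes> a" using c m_comm assms by blast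
next
  assume "\<exists>c\<in>carrier G - {\<one>}. b = c \<otimes> a"
  then obtain c where c: "c \<in> carrier G" "c \<noteq> \<one>" "b = c \<otimes> a" by blast
  have "a divides b" using c assms m_comm by blast
  moreover have "\<not> b divides a"
    using divides_antisym[OF assms \<open>a divides b\<close>] c mult_left_fixed assms by auto
  ultimately show "properfactor G a b" unfolding properfactor_def by blast
qed

lemma principal_ideal_subset_iff:
  assumes "a \<in> carrier G" "b \<in> carrier G"
  shows "principal_ideal G a \<subseteq> principal_ideal G b \<longleftrightarrow> b divides a"
proof
  assume sub: "principal_ideal G a \<subseteq> principal_ideal G b"
  have "a \<otimes> \<one> \<in> principal_ideal G a"
    unfolding principal_ideal_def l_coset_def by blast
  then show "b divides a"
    using sub assms unfolding principal_ideal_def l_coset_def by auto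
next
  assume "b divides a"
  then obtain c where c: "c \<in> carrier G" "a = b \<otimes> c" by blast
  have "a \<otimes> m \<in> principal_ideal G b" if "m \<in> carrier G" for m
  proof -
    have "a \<otimes> m = b \<otimes> (c \<otimes> m)" using that c assms m_assoc by simp
    then show ?thesis using that c unfolding principal_ideal_def l_coset_def by blast
  qed
  then show "principal_ideal G a \<subseteq> principal_ideal G b"
    unfolding principal_ideal_def[of G a] l_coset_def by blast
qed

text \<open>
  Principal ideals grow as their generators shrink under divisibility, and a generator is
  determined by its ideal because there are no associates to choose from.
\<close>

lemma ACCP_iff_wf_properfactor:
  "ACCP G \<longleftrightarrow> wf {(x, y). x \<in> carrier G \<and> y \<in> carrier G \<and> properfactor G x y}"
    (is "_ \<longleftrightarrow> wf ?r")
proof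
  assume accp: "ACCP G"
  show "wf ?r"
    unfolding wf_iff_no_infinite_down_chain
  proof
    assume "\<exists>f. \<forall>i. (f (Suc i), f i) \<in> ?r"
    then obtain f where f: "\<And>i. f i \<in> carrier G" "\<And>i. properfactor G (f (Suc i)) (f i)"
      by auto
    have "\<And>i. principal_ideal G (f i) \<subseteq> principal_ideal G (f (Suc i))"
      using principal_ideal_subset_iff f unfolding properfactor_def by simp
    with accp f(1) have "\<exists>n0. \<forall>n\<ge>n0. principal_ideal G (f n) = principal_ideal G (f (Suc n))"
      unfolding ACCP_def by simp
    then obtain i where "principal_ideal G (f i) = principal_ideal G (f (Suc i))"
      by blast
    then have "f i divides f (Suc i)"
      using principal_ideal_subset_iff[OF f(1) f(1), of "Suc i" i] by simp
    then show False using f(2)[of i] unfolding properfactor_def by blast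
  qed
next
  assume wf: "wf ?r"
  show "ACCP G"
    unfolding ACCP_def
  proof (intro allI impI)
    fix b :: "nat \<Rightarrow> 'a"
    assume "\<forall>n. b n \<in> carrier G"
      and chain: "\<forall>n. principal_ideal G (b n) \<subseteq> principal_ideal G (b (Suc n))"
    then have b: "\<And>n. b n \<in> carrier G" by blast
    obtain n0 where min: "\<And>y. (y, b n0) \<in> ?r \<Longrightarrow> y \<notin> range b"
      using wfE_min[OF wf, of "b 0" "range b"] by blast
    have const: "b n = b n0" if "n \<ge> n0" for n
    proof -
      have "principal_ideal G (b n0) \<subseteq> principal_ideal G (b n)"
        using chain that lift_Suc_mono_le[of "\<lambda>n. principal_ideal G (b n)"] by blast
      then have "b n divides b n0" using principal_ideal_subset_iff b by blast
      moreover have "\<not> properfactor G (b n) (b n0)" using min[of "b n"] b by blast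
      ultimately show ?thesis using divides_antisym b unfolding properfactor_def by blast
    qed
    show "\<exists>n0. \<forall>n\<ge>n0. principal_ideal G (b n) = principal_ideal G (b (Suc n))"
    proof (intro exI allI impI)
      fix n assume "n \<ge> n0"
      then show "principal_ideal G (b n) = principal_ideal G (b (Suc n))"
        using const[of n] const[of "Suc n"] by simp
    qed
  qed
qed

lemma Units_submonoid:
  assumes "submonoid N G"
  shows "Units (G\<lparr>carrier := N\<rparr>) = {\<one>}"
proof -
  interpret N: submonoid N G by fact
  show ?thesis
    using mult_eq_one N.subset unfolding Units_def by auto
qed

section \<open>The ACCP makes every submonoid atomic\<close>

lemma foldr_mult_append:
  assumes "set xs \<subseteq> carrier G" "set ys \<subseteq> carrier G"
  shows "foldr (\<otimes>) xs \<one> \<otimes> foldr (\<otimes>) ys \<one> = foldr (\<otimes>) (xs @ ys) \<one>"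
  using assms
proof (induction xs)
  case Nil
  then show ?case using multlist_closed[of ys] by simp
next
  case (Cons a xs)
  then show ?case using multlist_closed[of ys] multlist_closed[of xs]
    by (simp add: m_assoc)
qed

text \<open>
  An element of a submonoid that is neither \<open>\<one>\<close> nor an atom is a product of two elements of
  the submonoid, each of which properly divides it already in the large monoid.
\<close>

lemma wf_properfactor_imp_hereditarily_atomic:
  assumes wf: "wf {(x, y). x \<in> carrier G \<and> y \<in> carrier G \<and> properfactor G x y}"
  shows "hereditarily_atomic G"
  unfolding hereditarily_atomic_def atomic_monoid_def
proof (intro allI impI ballI)
  fix N a
  assume N: "submonoid N G" and aN: "a \<in> carrier (G\<lparr>carrier := N\<rparr>)"
  interpret N: submonoid N G by fact
  let ?N = "G\<lparr>carrier := N\<rparr>"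
  have atoms_in: "x \<in> carrier G" if "monoid_atom ?N x" for x
    using that N.subset unfolding monoid_atom_def by auto
  have "a \<in> N" using aN by simp
  with wf have "\<exists>as. (\<forall>x\<in>set as. monoid_atom ?N x) \<and> a = foldr (\<otimes>) as \<one>"
  proof (induction a rule: wf_induct_rule)
    case (less a)
    have a: "a \<in> carrier G" using less.prems N.subset by blast
    consider "a = \<one>" | "monoid_atom ?N a" | "a \<noteq> \<one>" "\<not> monoid_atom ?N a" by blast
    then show ?case
    proof cases
      case 1
      then show ?thesis by (intro exI[of _ "[]"]) simp
    next
      case 2
      then show ?thesis using a by (intro exI[of _ "[a]"]) simp
    next
      case 3
      then obtain b c where bc: "b \<in> N" "c \<in> N" "a = b \<otimes> c" "b \<noteq> \<one>" "c \<noteq> \<one>"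
        using less.prems Units_submonoid[OF N] unfolding monoid_atom_def by auto
      have car: "b \<in> carrier G" "c \<in> carrier G" using bc N.subset by auto
      have "properfactor G b a" "properfactor G c a"
        using properfactor_iff[OF car(1) a] properfactor_iff[OF car(2) a] bc(3-5) car
          m_comm[OF car] by (metis Diff_iff singletonD)+
      then obtain bs cs where
        bs: "\<forall>x\<in>set bs. monoid_atom ?N x" "b = foldr (\<otimes>) bs \<one>" and
        cs: "\<forall>x\<in>set cs. monoid_atom ?N x" "c = foldr (\<otimes>) cs \<one>"
        using less.IH[of b] less.IH[of c] car a bc(1,2) by auto
      have "a = foldr (\<otimes>) (bs @ cs) \<one>"
        using bc(3) bs cs foldr_mult_append[of bs cs] atoms_in by blast
      then show ?thesis using bs cs by (intro exI[of _ "bs @ cs"]) auto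
    qed
  qed
  then show "atomic_element ?N a" unfolding atomic_element_def by simp
qed

section \<open>Generated submonoids\<close>

inductive_set span :: "'a set \<Rightarrow> 'a set" for A :: "'a set" where
  one: "\<one> \<in> span A"
| mult: "a \<in> A \<Longrightarrow> x \<in> span A \<Longrightarrow> a \<otimes> x \<in> span A"

lemma span_closed:
  assumes "x \<in> span A" "A \<subseteq> carrier G"
  shows "x \<in> carrier G"
  using assms by (induction rule: span.induct) auto

lemma span_mult_closed:
  assumes "x \<in> span A" "y \<in> span A" "A \<subseteq> carrier G"
  shows "x \<otimes> y \<in> span A"
  using assms
proof (induction rule: span.induct)
  case one
  then show ?case using span_closed by simp
next
  case (mult a x)
  then have "a \<otimes> x \<otimes> y = a \<otimes> (x \<otimes> y)"
    using span_closed m_assoc by blast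
  then show ?case using mult span.mult by simp
qed

lemma submonoid_span:
  assumes "A \<subseteq> carrier G"
  shows "submonoid (span A) G"
  using assms span_closed span_mult_closed span.one by unfold_locales auto

lemma span_base:
  assumes "a \<in> A" "A \<subseteq> carrier G"
  shows "a \<in> span A"
  using span.mult[OF assms(1) span.one] assms by auto

lemma span_mono:
  assumes "x \<in> span A" "A \<subseteq> B"
  shows "x \<in> span B"
  using assms by (induction rule: span.induct) (auto intro: span.intros)

lemma foldr_in_span:
  assumes "set as \<subseteq> A"
  shows "foldr (\<otimes>) as \<one> \<in> span A"
  using assms by (induction as) (auto intro: span.intros)

lemma span_empty: "span {} = {\<one>}"
  by (auto intro: span.intros elim: span.cases)

lemma span_insert:
  assumes "x \<in> span (insert a A)" "a \<in> carrier G" "A \<subseteq> carrier G"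
  shows "\<exists>m::nat. \<exists>d\<in>span A. x = a [^] m \<otimes> d"
  using assms
proof (induction rule: span.induct)
  case one
  show ?case by (intro exI[of _ 0] bexI[of _ "\<one>"]) (auto intro: span.intros)
next
  case (mult e x)
  then obtain m :: nat and d where d: "d \<in> span A" "x = a [^] m \<otimes> d" by blast
  have dc: "d \<in> carrier G" using d span_closed mult by blast
  show ?case
  proof (cases "e = a")
    case True
    then have "e \<otimes> x = a [^] Suc m \<otimes> d"
      using d dc mult nat_pow_Suc2 m_assoc by simp
    then show ?thesis using d by blast
  next
    case False
    then have e: "e \<in> A" using mult by blast
    then have "e \<otimes> x = a [^] m \<otimes> (e \<otimes> d)"
      using d dc mult by (auto simp: m_lcomm)
    then show ?thesis using span.mult[OF e d(1)] by blast
  qed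
qed

text \<open>A product of generators uses only finitely many of them.\<close>

lemma span_mono_Union:
  fixes A :: "nat \<Rightarrow> 'a set"
  assumes "x \<in> span (\<Union>k. A k)" "mono A"
  shows "\<exists>k. x \<in> span (A k)"
  using assms
proof (induction rule: span.induct)
  case one
  then show ?case by (auto intro: span.intros)
next
  case (mult a x)
  then obtain k l where kl: "a \<in> A k" "x \<in> span (A l)" by blast
  have "a \<in> A (max k l)" "x \<in> span (A (max k l))"
    using kl mult(4) span_mono[of x "A l" "A (max k l)"]
    by (auto dest: monoD[of A k "max k l"] monoD[of A l "max k l"])
  then show ?case using span.mult by blast
qed

lemma atom_of_span:
  assumes A: "A \<subseteq> carrier G" and atom: "monoid_atom (G\<lparr>carrier := span A\<rparr>) x"
  shows "x \<in> A"
proof -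
  note units = Units_submonoid[OF submonoid_span[OF A]]
  have x: "x \<in> span A" "x \<noteq> \<one>" using atom units unfolding monoid_atom_def by auto
  \<comment> \<open>The identity may be one of the generators, so a nontrivial generator has to be split off.\<close>
  have "\<exists>a\<in>A. a \<noteq> \<one> \<and> (\<exists>y\<in>span A. x = a \<otimes> y)"
    using x
  proof (induction rule: span.induct)
    case one
    then show ?case by simp
  next
    case (mult a y)
    then show ?case using A span_closed[OF mult(2) A]
      by (cases "a = \<one>") auto
  qed
  then obtain a y where ay: "a \<in> A" "a \<noteq> \<one>" "y \<in> span A" "x = a \<otimes> y" by blast
  then have "y = \<one>"
    using atom units span_base[OF ay(1) A] unfolding monoid_atom_def by auto
  then show ?thesis using ay A by auto
qed

section \<open>Descending chains in a hereditarily atomic monoid\<close>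

text \<open>
  In the submonoid generated by all \<open>b n\<close> and \<open>c n\<close>, the defining factorization of \<open>b n\<close>
  shows that \<open>b n\<close> is an atom only if it equals \<open>c n\<close>. All atoms of this
  submonoid are therefore among the \<open>c n\<close>.
\<close>

lemma chain_start_in_span:
  fixes b c :: "nat \<Rightarrow> 'a"
  assumes ha: "hereditarily_atomic G"
    and b: "\<And>n. b n \<in> carrier G"
    and c: "\<And>n. c n \<in> carrier G - {\<one>}"
    and bc: "\<And>n. b n = c n \<otimes> b (Suc n)"
  shows "b 0 \<in> span (range c)"
proof -
  define A where "A = range b \<union> range c"
  have A: "A \<subseteq> carrier G" using b c unfolding A_def by auto
  let ?N = "G\<lparr>carrier := span A\<rparr>"
  note units = Units_submonoid[OF submonoid_span[OF A]]
  have gen: "b n \<in> span A" "c n \<in> span A" for n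
    using span_base[OF _ A] unfolding A_def by auto
  have atoms: "x \<in> range c" if atom: "monoid_atom ?N x" for x
  proof (rule ccontr)
    assume not_c: "x \<notin> range c"
    then obtain n where x: "x = b n"
      using atom_of_span[OF A atom] unfolding A_def by blast
    have "c n = \<one> \<or> b (Suc n) = \<one>"
      using atom gen bc[of n] units unfolding x monoid_atom_def by auto
    then have "b n = c n" using bc[of n] c[of n] by auto
    then show False using not_c x by blast
  qed
  have "atomic_element ?N (b 0)"
    using ha submonoid_span[OF A] gen
    unfolding hereditarily_atomic_def atomic_monoid_def by simp
  then consider "b 0 = \<one>"
    | as where "\<forall>x\<in>set as. monoid_atom ?N x" "b 0 = foldr (\<otimes>) as \<one>"
    using units unfolding atomic_element_def by auto
  then show ?thesis
  proof cases
    case 1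
    then show ?thesis by (simp add: span.one)
  next
    case 2
    then show ?thesis using foldr_in_span[of as "range c"] atoms by auto
  qed
qed

text \<open>
  If all powers of \<open>d\<close> divided \<open>x\<close>, then \<open>x\<close> would start a chain with constant quotient
  \<open>d\<close>, hence be a power of \<open>d\<close>, which the next power of \<open>d\<close> cannot divide.
\<close>

lemma finite_dividing_powers:
  assumes ha: "hereditarily_atomic G"
    and d: "d \<in> carrier G - {\<one>}" and x: "x \<in> carrier G"
  shows "finite {m::nat. d [^] m divides x}"
proof (cases "\<forall>m::nat. d [^] m divides x")
  case True
  then have "\<forall>m::nat. \<exists>y\<in>carrier G. x = d [^] m \<otimes> y" by blast
  then obtain b where b: "\<And>m::nat. b m \<in> carrier G" "\<And>m. x = d [^] m \<otimes> b m" by metis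
  have "b m = d \<otimes> b (Suc m)" for m
  proof -
    have "d [^] m \<otimes> b m = d [^] m \<otimes> (d \<otimes> b (Suc m))"
      using b(2)[of m] b(2)[of "Suc m"] b(1)[of "Suc m"] d by (simp add: m_assoc)
    then show ?thesis using l_cancel b(1) d by auto
  qed
  then have "b 0 \<in> span (range (\<lambda>_::nat. d))"
    using chain_start_in_span[OF ha, of b "\<lambda>_. d"] b(1) d by blast
  then have "x \<in> span {d}" using b(2)[of 0] b(1)[of 0] by simp
  then obtain m :: nat where m: "x = d [^] m"
    using span_insert[of x d "{}"] d span_empty by auto
  have "d \<otimes> b (Suc m) \<otimes> d [^] m = d [^] m"
    using b(2)[of "Suc m"] b(1)[of "Suc m"] d m by (simp add: m_ac)
  then have "d \<otimes> b (Suc m) = \<one>"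
    using mult_left_fixed[of "d \<otimes> b (Suc m)" "d [^] m"] b(1) d by simp
  then show ?thesis using mult_eq_one d b(1) by blast
next
  case False
  then obtain k :: nat where k: "\<not> d [^] k divides x" by blast
  have "m < k" if "d [^] m divides x" for m :: nat
  proof (rule ccontr)
    assume "\<not> m < k"
    then have "d [^] m = d [^] k \<otimes> d [^] (m - k)" using nat_pow_mult d by simp
    then have "d [^] k divides d [^] m" using d by auto
    then show False using divides_trans[OF _ that] k d by simp
  qed
  then have "{m::nat. d [^] m divides x} \<subseteq> {..<k}" by auto
  then show ?thesis by (rule finite_subset) simp
qed

text \<open>
  Induction on the number of generators: a cofactor with respect to \<open>insert a A\<close> arises from
  one with respect to \<open>A\<close> by splitting off a power of \<open>a\<close>, and by cancellation it is determined
  by the old cofactor and the exponent. Only finitely many exponents are possible.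
\<close>

lemma finite_cofactors:
  assumes ha: "hereditarily_atomic G"
    and "finite A" "A \<subseteq> carrier G - {\<one>}" and x: "x \<in> carrier G"
  shows "finite {t \<in> carrier G. \<exists>d\<in>span A. x = d \<otimes> t}"
  using assms(2,3)
proof (induction A rule: finite_induct)
  case empty
  have "{t \<in> carrier G. \<exists>d\<in>span {}. x = d \<otimes> t} \<subseteq> {x}" by (auto simp: span_empty)
  then show ?case using finite_subset by blast
next
  case (insert a A)
  let ?T = "{t \<in> carrier G. \<exists>d\<in>span A. x = d \<otimes> t}"
  let ?P = "SIGMA s:?T. {m::nat. a [^] m divides s}"
  have a: "a \<in> carrier G - {\<one>}" and A: "A \<subseteq> carrier G" using insert by auto
  have "finite ?P" using insert finite_dividing_powers[OF ha a] by auto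
  moreover have "{t \<in> carrier G. \<exists>d\<in>span (insert a A). x = d \<otimes> t}
      \<subseteq> (\<lambda>(s, m). THE t. t \<in> carrier G \<and> s = a [^] m \<otimes> t) ` ?P"
  proof
    fix t assume "t \<in> {t \<in> carrier G. \<exists>d\<in>span (insert a A). x = d \<otimes> t}"
    then obtain d where t: "t \<in> carrier G" and "d \<in> span (insert a A)" and xdt: "x = d \<otimes> t"
      by blast
    then obtain m :: nat and e where e: "e \<in> span A" "d = a [^] m \<otimes> e"
      using span_insert a A by blast
    have ec: "e \<in> carrier G" using span_closed e A by blast
    let ?s = "a [^] m \<otimes> t"
    have "x = e \<otimes> ?s" using xdt e ec t a by (simp add: m_ac)
    then have "?s \<in> ?T" using e t a by auto
    moreover have "a [^] m divides ?s" using t by blast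
    moreover have "(THE t'. t' \<in> carrier G \<and> ?s = a [^] m \<otimes> t') = t"
      using t a l_cancel[of "a [^] m"] by (intro the_equality) auto
    ultimately show "t \<in> (\<lambda>(s, m). THE t. t \<in> carrier G \<and> s = a [^] m \<otimes> t) ` ?P"
      by (intro image_eqI[of _ _ "(?s, m)"]) auto
  qed
  ultimately show ?case using finite_surj by blast
qed

text \<open>
  If every index \<open>j > n\<close> were bad, \<open>x\<close> would have a cofactor \<open>(e j) [^] m\<close> with respect to
  \<open>span A\<close>, where \<open>e j\<close> is the quotient of \<open>b n\<close> by \<open>b j\<close> and \<open>m > 0\<close>. Cofactors range over
  a finite set, and so do the exponents, because \<open>e (Suc n)\<close> divides every \<open>e j\<close> and only
  finitely many of its powers divide a given cofactor. So two of these cofactors agree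
  together with their exponents, and cancelling in \<open>b n [^] m = e j [^] m \<otimes> b j [^] m\<close> gives
  equal powers of two terms of the chain.
\<close>

lemma chain_step:
  fixes b :: "nat \<Rightarrow> 'a"
  assumes ha: "hereditarily_atomic G"
    and A: "finite A" "A \<subseteq> carrier G - {\<one>}"
    and x: "x \<in> carrier G" "x \<notin> span A"
    and b: "\<And>n. b n \<in> carrier G"
    and chain: "\<And>i j. i < j \<Longrightarrow> \<exists>c\<in>carrier G - {\<one>}. b i = c \<otimes> b j"
  shows "\<exists>j>n. \<exists>c\<in>carrier G - {\<one>}. b n = c \<otimes> b j \<and> x \<notin> span (insert c A)"
proof (rule ccontr)
  assume "\<not> ?thesis"
  then have bad: "x \<in> span (insert c A)"
    if "j > n" "c \<in> carrier G - {\<one>}" "b n = c \<otimes> b j" for j c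
    using that by blast
  have Ac: "A \<subseteq> carrier G" using A by blast
  let ?T = "{t \<in> carrier G. \<exists>d\<in>span A. x = d \<otimes> t}"
  obtain u where u: "u \<in> carrier G - {\<one>}" "b n = u \<otimes> b (Suc n)"
    using chain[of n "Suc n"] by auto
  let ?P = "SIGMA s:?T. {m::nat. u [^] m divides s}"
  have finP: "finite ?P"
    using finite_cofactors[OF ha A x(1)] finite_dividing_powers[OF ha u(1)] by auto
  have "\<exists>s m. (s, m) \<in> ?P \<and> m > 0 \<and> b n [^] m = s \<otimes> b j [^] m" if j: "j > n" for j
  proof -
    obtain e where e: "e \<in> carrier G - {\<one>}" "b n = e \<otimes> b j" using chain[OF j] by blast
    obtain m :: nat and d where d: "d \<in> span A" "x = e [^] m \<otimes> d"
      using span_insert[OF bad[OF j e]] e Ac by blast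
    have dc: "d \<in> carrier G" using span_closed d Ac by blast
    have "m > 0"
    proof (rule ccontr)
      assume "\<not> m > 0"
      then have "x = d" using d dc by simp
      then show False using d x by blast
    qed
    have T: "e [^] m \<in> ?T" using d dc e m_comm[of "e [^] m" d] by auto
    have "\<exists>v\<in>carrier G. b (Suc n) = v \<otimes> b j"
    proof (cases "j = Suc n")
      case True
      then show ?thesis using b by (intro bexI[of _ "\<one>"]) auto
    next
      case False
      then show ?thesis using chain[of "Suc n" j] j by auto
    qed
    then obtain v where v: "v \<in> carrier G" "b (Suc n) = v \<otimes> b j" by blast
    have "e \<otimes> b j = (u \<otimes> v) \<otimes> b j"
      using e u v b by (metis DiffD1 m_assoc)
    then have "e = u \<otimes> v" using r_cancel[of e "b j"] e u v b by auto
    then have "e [^] m = u [^] m \<otimes> v [^] m" using nat_pow_distrib u v by simp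
    then have "u [^] m divides e [^] m" using v by auto
    moreover have "b n [^] m = e [^] m \<otimes> b j [^] m" using e b nat_pow_distrib by simp
    ultimately show ?thesis using T \<open>m > 0\<close> by blast
  qed
  then have "\<forall>j\<in>{n<..}. \<exists>p. p \<in> ?P \<and> snd p > 0 \<and> b n [^] snd p = fst p \<otimes> b j [^] snd p"
    by fastforce
  from bchoice[OF this] obtain p where p: "\<And>j. j > n \<Longrightarrow> p j \<in> ?P" "\<And>j. j > n \<Longrightarrow> snd (p j) > 0"
    "\<And>j. j > n \<Longrightarrow> b n [^] snd (p j) = fst (p j) \<otimes> b j [^] snd (p j)"
    by auto
  have "p ` {n<..} \<subseteq> ?P" using p(1) by blast
  then have "\<not> inj_on p {n<..}"
    using finP inj_on_finite infinite_Ioi by blast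
  then obtain i j where ij: "i > n" "i < j" "p i = p j"
    unfolding inj_on_def by (metis greaterThan_iff linorder_neqE_nat)
  define s m where "s = fst (p i)" and "m = snd (p i)"
  have s: "s \<in> carrier G" using p(1)[OF ij(1)] unfolding s_def by (cases "p i") simp
  have m: "m > 0" using p(2) ij unfolding m_def by blast
  have "s \<otimes> b i [^] m = s \<otimes> b j [^] m"
    using p(3)[of i] p(3)[of j] ij unfolding s_def m_def by simp
  then have eq: "b i [^] m = b j [^] m" using l_cancel s b by simp
  obtain c where c: "c \<in> carrier G - {\<one>}" "b i = c \<otimes> b j" using chain[OF ij(2)] by blast
  have "c [^] m \<otimes> b j [^] m = b j [^] m" using eq c b nat_pow_distrib by simp
  then have "c [^] m = \<one>" using mult_left_fixed[of "c [^] m" "b j [^] m"] c b by simp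
  then show False using pow_eq_one m c by blast
qed

text \<open>
  Iterating \<open>chain_step\<close> selects a subchain whose set of quotients is an increasing union of
  finite sets, none of which generates the starting element; neither does their union.
\<close>

lemma hereditarily_atomic_imp_wf_properfactor:
  assumes ha: "hereditarily_atomic G"
  shows "wf {(x, y). x \<in> carrier G \<and> y \<in> carrier G \<and> properfactor G x y}" (is "wf ?r")
  unfolding wf_iff_no_infinite_down_chain
proof
  assume "\<exists>f. \<forall>i. (f (Suc i), f i) \<in> ?r"
  then obtain b where b: "\<And>i. b i \<in> carrier G" "\<And>i. properfactor G (b (Suc i)) (b i)"
    by auto
  have pf: "properfactor G (b j) (b i)" if "i < j" for i j
    using that
  proof (induction rule: less_Suc_induct)
    case (1 i)
    show ?case by (rule b(2))
  next
    case (2 i j k)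
    then show ?case using properfactor_trans1[of "b k" "b j" "b i"] b(1)
      unfolding properfactor_def by blast
  qed
  then have chain: "\<exists>c\<in>carrier G - {\<one>}. b i = c \<otimes> b j" if "i < j" for i j
    using that properfactor_iff b(1) by blast
  define P where
    "P S \<longleftrightarrow> finite (snd S) \<and> snd S \<subseteq> carrier G - {\<one>} \<and> b 0 \<notin> span (snd S)"
    for S :: "nat \<times> 'a set"
  define Q where
    "Q S S' \<longleftrightarrow> (\<exists>c\<in>carrier G - {\<one>}. b (fst S) = c \<otimes> b (fst S') \<and> snd S' = insert c (snd S))"
    for S S' :: "nat \<times> 'a set"
  have "b 0 \<noteq> \<one>"
  proof
    assume "b 0 = \<one>"
    moreover obtain c where "c \<in> carrier G - {\<one>}" "b 0 = c \<otimes> b 1" using chain[of 0 1] by auto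
    ultimately show False using mult_eq_one[of c "b 1"] b(1) by auto
  qed
  then have P0: "P (0, {})" unfolding P_def by (simp add: span_empty)
  have step: "\<exists>S'. P S' \<and> Q S S'" if "P S" for S
  proof -
    have S: "finite (snd S)" "snd S \<subseteq> carrier G - {\<one>}" "b 0 \<notin> span (snd S)"
      using that unfolding P_def by auto
    obtain j c where "c \<in> carrier G - {\<one>}" "b (fst S) = c \<otimes> b j" "b 0 \<notin> span (insert c (snd S))"
      using chain_step[OF ha S(1,2) b(1) S(3), of b "fst S"] b(1) chain by blast
    then have "P (j, insert c (snd S)) \<and> Q S (j, insert c (snd S))"
      using S unfolding P_def Q_def by auto
    then show ?thesis by blast
  qed
  obtain S where S0: "S 0 = (0, {})" and S: "\<And>k. P (S k)" "\<And>k. Q (S k) (S (Suc k))"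
    using dependent_nat_choice[of "\<lambda>k s. P s \<and> (k = 0 \<longrightarrow> s = (0, {}))" "\<lambda>_. Q"] P0 step
    by auto
  then obtain c where c: "\<And>k. c k \<in> carrier G - {\<one>}"
    "\<And>k. b (fst (S k)) = c k \<otimes> b (fst (S (Suc k)))"
    "\<And>k. snd (S (Suc k)) = insert (c k) (snd (S k))"
    unfolding Q_def by metis
  have "b (fst (S 0)) \<in> span (range c)"
    using chain_start_in_span[OF ha, of "\<lambda>k. b (fst (S k))" c] b(1) c(1,2) by blast
  then have "b 0 \<in> span (range c)" using S0 by simp
  moreover have "range c \<subseteq> (\<Union>k. snd (S k))" using c(3) by blast
  ultimately have "b 0 \<in> span (\<Union>k. snd (S k))" using span_mono by blast
  moreover have "mono (\<lambda>k. snd (S k))" using c(3) by (auto simp: mono_iff_le_Suc)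
  ultimately obtain k where "b 0 \<in> span (snd (S k))" using span_mono_Union by blast
  then show False using S(1)[of k] unfolding P_def by blast
qed

end

section \<open>The equivalence\<close>

theorem corollary4p5:
  fixes M :: "('a, 'b) monoid_scheme"
  assumes "reduced_monoid M"
  shows "hereditarily_atomic M \<longleftrightarrow> ACCP M"
proof -
  interpret reduced_comm_monoid M
    using assms unfolding reduced_monoid_def reduced_comm_monoid_def
      reduced_comm_monoid_axioms_def by blast
  show ?thesis
    using ACCP_iff_wf_properfactor hereditarily_atomic_imp_wf_properfactor
      wf_properfactor_imp_hereditarily_atomic by blast
qed

end
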